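(* Let $\lambda>0$. For $u>0$ let $\varphi:\mathbb{R}^2\to\{0,1\}$ be the random field $\varphi(x)=\mathbf{1}_{\{x\in\mathcal{L}\}}$, where $\mathcal{L}$ is the union of the closed cylinders of base-radius $r=2$ around the lines of a Poisson line process of intensity $u$ (see context; this is the cylinder field with $r=2$ and cylinder-value distribution $F$ equal to a point mass at $1$), and let $\Phi$ be its marginal distribution function. For $s>0$ let $L_s$ be the line segment between $(0,0)$ and $(s,0)$. Then there exists $u_0>0$ such that for every $u\in(0,u_0)$ there is $s_0=s_0(u)>0$ such that $$\mathbf{P}_\lambda(L_s\subseteq\mathcal{O})>\mathbb{P}_\lambda(L_s\subseteq\mathcal{O}_\Phi)\quad\text{for all }s\ge s_0.$$
   Context: Poisson line process of intensity $u$: for $(\theta,t)\in[0,2\pi)\times[0,\infty)$ let $\ell_\theta$ be the half-line from the origin at angle $\theta$ with the first coordinate axis and $\ell(\theta,t)$ the line perpendicular to $\ell_\theta$ meeting it at distance $t$ from the origin; the line process is $\{\ell(\theta,t):(\theta,t)\in X\}$ with $X$ a homogeneous Poisson point process on $[0,2\pi)\times[0,\infty)$ of intensity $u$. The cylinder of base-radius $r$ around $\ell$ is the closed set of points within Euclidean distance $r$ of $\ell$. The models: $\eta$ is a homogeneous Poisson point process on $\mathbb{R}^2\times[0,1]$ with intensity $\lambda$ and law $\mathbb{P}_\lambda$, independent of $\varphi$; $\mathbf{P}_\lambda$ is the joint law of $(\eta,\varphi)$. $\Phi(x)$ is the probability that $\varphi(0)\le x$, $\Phi^{-1}(z)=\inf\{x\in\mathbb{R}:\Phi(x)\ge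 z\}$, $B(x,r)$ is the closed Euclidean disc, and $$\mathcal{O}=\bigcup_{(x,z)\in\eta}B(x,\varphi(x)),\qquad\mathcal{O}_\Phi=\bigcup_{(x,z)\in\eta}B(x,\Phi^{-1}(z)).$$ *)

theory Defs
  imports "HOL-Probability.Probability"
begin

text \<open>
  Point processes are modelled as random sets: the intensity measures below have no atoms, so
  multiplicities do not occur. Configurations are finite on bounded sets, hence \<open>card\<close> is used
  on finite sets only.
\<close>

definition configurations :: "'a::euclidean_space set \<Rightarrow> 'a set set" where
  "configurations D = {S. S \<subseteq> D \<and> (\<forall>B. bounded B \<longrightarrow> finite (S \<inter> B))}"

definition config_space :: "'a::euclidean_space set \<Rightarrow> 'a set measure" where
  "config_space D = sigma (configurations D)
     {{S \<in> configurations D. card (S \<inter> A) = n} | A n. A \<in> sets borel \<and> bounded A}"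

text \<open>The Poisson distribution with mean \<open>m \<ge> 0\<close>; \<open>poisson_pmf\<close> is specified for \<open>m > 0\<close> only.\<close>

definition poisson_dist :: "real \<Rightarrow> nat pmf" where
  "poisson_dist m = (if m = 0 then return_pmf 0 else poisson_pmf m)"

definition poisson_process ::
    "'w measure \<Rightarrow> 'a::euclidean_space set \<Rightarrow> real \<Rightarrow> ('w \<Rightarrow> 'a set) \<Rightarrow> bool" where
  "poisson_process M D u N \<longleftrightarrow>
     N \<in> measurable M (config_space D) \<and>
     (\<forall>A \<in> sets borel. bounded A \<longrightarrow>
        distr M (count_space UNIV) (\<lambda>\<omega>. card (N \<omega> \<inter> A)) =
          measure_pmf (poisson_dist (u * measure lborel (A \<inter> D)))) \<and>
     (\<forall>\<A>. finite \<A> \<longrightarrow> disjoint \<A> \<longrightarrow> (\<forall>A\<in>\<A>. A \<in> sets borel \<and> bounded A) \<longrightarrow>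
        prob_space.indep_vars M (\<lambda>_. count_space UNIV) (\<lambda>A \<omega>. card (N \<omega> \<inter> A)) \<A>)"

type_synonym plane = "real \<times> real"

definition direction :: "real \<Rightarrow> plane" where
  "direction \<theta> = (cos \<theta>, sin \<theta>)"

definition line :: "real \<Rightarrow> real \<Rightarrow> plane set" where
  "line \<theta> t = {x. orthogonal (x - t *\<^sub>R direction \<theta>) (direction \<theta>)}"

definition line_params :: "(real \<times> real) set" where
  "line_params = {0..<2 * pi} \<times> {0..}"

definition cylinder :: "real \<Rightarrow> plane set \<Rightarrow> plane set" where
  "cylinder r l = {x. infdist x l \<le> r}"

definition cylinder_union :: "real \<Rightarrow> (real \<times> real) set \<Rightarrow> plane set" where
  "cylinder_union r X = (\<Union>(\<theta>, t)\<in>X. cylinder r (line \<theta> t))"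

definition cylinder_field :: "real \<Rightarrow> (real \<times> real) set \<Rightarrow> plane \<Rightarrow> real" where
  "cylinder_field r X = indicator (cylinder_union r X)"

definition marked_plane :: "(plane \<times> real) set" where
  "marked_plane = UNIV \<times> {0..1}"

definition field_boolean :: "(plane \<times> real) set \<Rightarrow> (plane \<Rightarrow> real) \<Rightarrow> plane set" where
  "field_boolean S f = (\<Union>(x, z)\<in>S. cball x (f x))"

definition marginal_cdf :: "'w measure \<Rightarrow> ('w \<Rightarrow> plane \<Rightarrow> real) \<Rightarrow> real \<Rightarrow> real" where
  "marginal_cdf M \<phi> = cdf (distr M borel (\<lambda>\<omega>. \<phi> \<omega> 0))"

text \<open>
  The infimum is over a nonempty set bounded below for \<open>0 < z < 1\<close>, and for the bounded fields
  used here also for \<open>z = 1\<close>. At \<open>z = 0\<close> the set is all of the reals and \<open>Inf\<close> is an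
  unspecified real, but almost surely no point of the Poisson process has mark \<open>0\<close>.
\<close>

definition quantile :: "(real \<Rightarrow> real) \<Rightarrow> real \<Rightarrow> real" where
  "quantile F z = Inf {x. F x \<ge> z}"

definition iid_boolean :: "(plane \<times> real) set \<Rightarrow> (real \<Rightarrow> real) \<Rightarrow> plane set" where
  "iid_boolean S F = (\<Union>(x, z)\<in>S. cball x (quantile F z))"

definition field_independent ::
    "'w measure \<Rightarrow> ('w \<Rightarrow> (plane \<times> real) set) \<Rightarrow> ('w \<Rightarrow> plane \<Rightarrow> real) \<Rightarrow> bool" where
  "field_independent M \<eta> \<phi> \<longleftrightarrow> prob_space.indep_set M
     (sets (vimage_algebra (space M) \<eta> (config_space marked_plane)))
     (sets (vimage_algebra (space M) \<phi> (\<Pi>\<^sub>M x\<in>UNIV. borel)))"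

end

theory Submission
  imports Defs "HOL-Real_Asymp.Real_Asymp"
begin

text \<open>
  With probability of order \<open>u / s\<close> a single line nearly parallel to the segment \<open>L\<^sub>s\<close> puts a whole
  strip around \<open>L\<^sub>s\<close> inside the cylinders; unit discs of intensity \<open>lam\<close> centered in this strip cover
  \<open>L\<^sub>s\<close> with a probability that is exponentially small in \<open>s\<close> at a rate independent of \<open>u\<close>. In the
  independent model the unit discs have intensity \<open>lam * (1 - exp (- 4 * pi * u))\<close>, and about
  \<open>s / 3\<close> points at mutual distance 3 must be covered, which are independent events of probability
  \<open>O(u)\<close>. For small \<open>u\<close> the second exponential rate is the worse one, and the factor \<open>u / s\<close> is
  negligible.
\<close>

subsection \<open>Hitting probabilities of Poisson processes\<close>

lemma space_config_space [simp]: "space (config_space D) = configurations D"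
  unfolding config_space_def by (rule space_measure_of) (auto simp: configurations_def)

lemma count_sets:
  assumes "A \<in> sets borel" "bounded A"
  shows "{S \<in> configurations D. card (S \<inter> A) = n} \<in> sets (config_space D)"
  unfolding config_space_def
  by (subst sets_measure_of) (use assms in \<open>auto intro!: sigma_sets.Basic\<close>)

text \<open>Complement of a count event. Since \<open>card\<close> is 0 on infinite sets too, local
  finiteness of configurations is what turns a zero count into an empty intersection.\<close>

lemma hit_sets:
  assumes N: "N \<in> measurable M (config_space D)" and A: "A \<in> sets borel" "bounded A"
  shows "{\<omega> \<in> space M. N \<omega> \<inter> A \<noteq> {}} \<in> sets M"
proof -
  have "N -` {S \<in> configurations D. card (S \<inter> A) = 0} \<inter> space M \<in> sets M"
    by (rule measurable_sets[OF N count_sets[OF A]])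
  moreover have "{\<omega> \<in> space M. N \<omega> \<inter> A \<noteq> {}} =
      space M - (N -` {S \<in> configurations D. card (S \<inter> A) = 0} \<inter> space M)"
    using measurable_space[OF N] A by (auto simp: configurations_def)
  ultimately show ?thesis by auto
qed

lemma pmf_poisson_dist_0: "m \<ge> 0 \<Longrightarrow> pmf (poisson_dist m) 0 = exp (- m)"
  by (auto simp: poisson_dist_def)

context prob_space
begin

lemma prob_hit:
  assumes "poisson_process M D u N" "u \<ge> 0" and A: "A \<in> sets borel" "bounded A"
  shows "prob {\<omega> \<in> space M. N \<omega> \<inter> A \<noteq> {}} = 1 - exp (- (u * measure lborel (A \<inter> D)))"
proof -
  let ?c = "\<lambda>\<omega>. card (N \<omega> \<inter> A)"
  have N: "N \<in> measurable M (config_space D)"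
    and d: "distr M (count_space UNIV) ?c = measure_pmf (poisson_dist (u * measure lborel (A \<inter> D)))"
    using assms by (auto simp: poisson_process_def)
  have eq: "{\<omega> \<in> space M. N \<omega> \<inter> A \<noteq> {}} = space M - (?c -` {0} \<inter> space M)"
    using measurable_space[OF N] A by (auto simp: configurations_def)
  \<comment> \<open>Measurability lets the law of the count be read as the probability of an event
    in \<open>M\<close>; on a countable target, preimages of singletons suffice.\<close>
  have c: "?c \<in> measurable M (count_space UNIV)"
  proof (rule measurable_count_space_eq2_countable[THEN iffD2], safe)
    fix n
    have "N -` {S \<in> configurations D. card (S \<inter> A) = n} \<inter> space M \<in> sets M"
      by (rule measurable_sets[OF N count_sets[OF A]])
    also have "N -` {S \<in> configurations D. card (S \<inter> A) = n} \<inter> space M = ?c -` {n} \<inter> space M"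
      using measurable_space[OF N] by auto
    finally show "?c -` {n} \<inter> space M \<in> sets M" .
  qed auto
  have "prob (?c -` {0} \<inter> space M) = measure (distr M (count_space UNIV) ?c) {0}"
    by (subst measure_distr[OF c]) auto
  also have "\<dots> = exp (- (u * measure lborel (A \<inter> D)))"
    unfolding d using \<open>u \<ge> 0\<close> by (simp add: measure_pmf_single pmf_poisson_dist_0)
  finally show ?thesis
    unfolding eq by (subst prob_compl) (use measurable_sets[OF c, of "{0}"] in auto)
qed

lemma prob_hit_all:
  assumes P: "poisson_process M D u N" "u \<ge> 0"
    and \<A>: "finite \<A>" "disjoint \<A>" "\<And>A. A \<in> \<A> \<Longrightarrow> A \<in> sets borel \<and> bounded A"
    and m: "\<And>A. A \<in> \<A> \<Longrightarrow> measure lborel (A \<inter> D) = m"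
  shows "prob {\<omega> \<in> space M. \<forall>A\<in>\<A>. N \<omega> \<inter> A \<noteq> {}} = (1 - exp (- (u * m))) ^ card \<A>"
proof (cases "\<A> = {}")
  \<comment> \<open>The empty family is separate: an empty intersection would be \<open>UNIV\<close>
    instead of \<open>space M\<close>, and the product rule for independent variables asks for a
    nonempty index set.\<close>
  case True
  then show ?thesis by (simp add: prob_space)
next
  case False
  let ?c = "\<lambda>A \<omega>. card (N \<omega> \<inter> A)"
  have N: "N \<in> measurable M (config_space D)"
    and ind: "indep_vars (\<lambda>_. count_space UNIV) ?c \<A>"
    using assms by (auto simp: poisson_process_def)
  have eq: "{\<omega> \<in> space M. N \<omega> \<inter> A \<noteq> {}} = ?c A -` (- {0}) \<inter> space M" if "A \<in> \<A>" for A
    using measurable_space[OF N] \<A>(3)[OF that] by (auto simp: configurations_def)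
  have "{\<omega> \<in> space M. \<forall>A\<in>\<A>. N \<omega> \<inter> A \<noteq> {}} = (\<Inter>A\<in>\<A>. {\<omega> \<in> space M. N \<omega> \<inter> A \<noteq> {}})"
    using False by auto
  also have "\<dots> = (\<Inter>A\<in>\<A>. ?c A -` (- {0}) \<inter> space M)"
    using eq by auto
  also have "prob \<dots> = (\<Prod>A\<in>\<A>. prob (?c A -` (- {0}) \<inter> space M))"
    by (rule indep_varsD[OF ind False \<A>(1)]) auto
  also have "\<dots> = (\<Prod>A\<in>\<A>. 1 - exp (- (u * m)))"
    by (intro prod.cong refl) (simp only: eq[symmetric] prob_hit[OF P] \<A>(3) m)
  finally show ?thesis by simp
qed

text \<open>Passes from a set of regions to an indexed family: disjoint nonempty regions are
  pairwise distinct, so no index is lost in the image and the exponent stays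
  \<open>card I\<close>.\<close>

lemma prob_hit_family:
  assumes P: "poisson_process M D u N" "u \<ge> 0" and "finite I"
    and A: "disjoint_family_on A I"
    and A': "\<And>i. i \<in> I \<Longrightarrow> A i \<in> sets borel \<and> bounded (A i) \<and> A i \<noteq> {} \<and>
      measure lborel (A i \<inter> D) = m"
  shows "prob {\<omega> \<in> space M. \<forall>i\<in>I. N \<omega> \<inter> A i \<noteq> {}} = (1 - exp (- (u * m))) ^ card I"
proof -
  have "disjoint (A ` I)" "inj_on A I"
    using A A' disjoint_family_on_iff_disjoint_image[of I A] by auto
  then show ?thesis
    using prob_hit_all[OF P, of "A ` I" m] A' \<open>finite I\<close> by (auto simp: card_image)
qed

end

subsection \<open>Measurability of pair events\<close>

lemma box_Times: "box (a, c) (b, d) = box a b \<times> box c d"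
  by (auto simp: box_def Basis_prod_def ball_Un)

lemma config_finite:
  assumes "S \<in> configurations D" "bounded B"
  shows "finite (S \<inter> B)"
  using assms by (auto simp: configurations_def)

text \<open>
  For an open set the event is a countable union of rectangle events. A compact set is the limit of
  open neighbourhoods, and only finitely many pairs of points meet a bounded neighbourhood.
\<close>

lemma pair_hit_open_sets:
  fixes C :: "('a::euclidean_space \<times> 'b::euclidean_space) set"
  assumes "N \<in> measurable M (config_space D)" "N' \<in> measurable M (config_space D')"
    and "open C"
  shows "{\<omega> \<in> space M. \<exists>p\<in>N \<omega>. \<exists>q\<in>N' \<omega>. (p, q) \<in> C} \<in> sets M"
proof -
  obtain \<B> where B: "countable \<B>" "\<And>X. X \<in> \<B> \<Longrightarrow> \<exists>a b. X = box a b" "\<Union>\<B> = C"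
    using open_countable_Union_open_box[OF \<open>open C\<close>] by metis
  have "{\<omega> \<in> space M. \<exists>p\<in>N \<omega>. \<exists>q\<in>N' \<omega>. (p, q) \<in> C} =
     (\<Union>X\<in>\<B>. {\<omega> \<in> space M. \<exists>p\<in>N \<omega>. \<exists>q\<in>N' \<omega>. (p, q) \<in> X})"
    using B(3) by blast
  also have "\<dots> \<in> sets M"
  proof (rule sets.countable_UN''[OF B(1)])
    fix X assume "X \<in> \<B>"
    then obtain a b where "X = box a b" using B(2) by blast
    then have X: "X = box (fst a) (fst b) \<times> box (snd a) (snd b)"
      using box_Times[of "fst a" "snd a" "fst b" "snd b"] by simp
    have "{\<omega> \<in> space M. \<exists>p\<in>N \<omega>. \<exists>q\<in>N' \<omega>. (p, q) \<in> X} =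
       {\<omega> \<in> space M. N \<omega> \<inter> box (fst a) (fst b) \<noteq> {}} \<inter>
       {\<omega> \<in> space M. N' \<omega> \<inter> box (snd a) (snd b) \<noteq> {}}"
      unfolding X by auto
    also have "\<dots> \<in> sets M"
      by (intro sets.Int hit_sets[OF assms(1)] hit_sets[OF assms(2)]) auto
    finally show "{\<omega> \<in> space M. \<exists>p\<in>N \<omega>. \<exists>q\<in>N' \<omega>. (p, q) \<in> X} \<in> sets M" .
  qed
  finally show ?thesis .
qed

lemma pair_hit_compact_sets:
  fixes C :: "('a::euclidean_space \<times> 'b::euclidean_space) set"
  assumes N: "N \<in> measurable M (config_space D)" "N' \<in> measurable M (config_space D')"
    and C: "compact C"
  shows "{\<omega> \<in> space M. \<exists>p\<in>N \<omega>. \<exists>q\<in>N' \<omega>. (p, q) \<in> C} \<in> sets M"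
proof -
  define U where "U n = (\<Union>c\<in>C. ball c (inverse (real (Suc n))))" for n
  have Uo: "open (U n)" for n unfolding U_def by auto
  have "(\<exists>p\<in>S. \<exists>q\<in>S'. (p, q) \<in> C) \<longleftrightarrow> (\<forall>n. \<exists>p\<in>S. \<exists>q\<in>S'. (p, q) \<in> U n)"
    if S: "S \<in> configurations D" "S' \<in> configurations D'" for S S'
  proof safe
    fix p q n assume "p \<in> S" "q \<in> S'" "(p, q) \<in> C"
    then show "\<exists>p\<in>S. \<exists>q\<in>S'. (p, q) \<in> U n"
      unfolding U_def by (intro bexI[of _ p] bexI[of _ q] UN_I[of "(p, q)"]) auto
  next
    assume hit: "\<forall>n. \<exists>p\<in>S. \<exists>q\<in>S'. (p, q) \<in> U n"
    \<comment> \<open>All pairs of points that can occur in any \<open>U n\<close>, since the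
      neighbourhoods decrease; finite because \<open>U 0\<close> is bounded.\<close>
    define F where "F = (S \<inter> fst ` U 0) \<times> (S' \<inter> snd ` U 0)"
    obtain b where b: "\<And>c. c \<in> C \<Longrightarrow> norm c \<le> b"
      using compact_imp_bounded[OF C] by (auto simp: bounded_iff)
    have "norm z \<le> b + 1" if z: "z \<in> U 0" for z
    proof -
      obtain c where "c \<in> C" "z \<in> ball c (inverse (real (Suc 0)))"
        using z unfolding U_def by blast
      then show ?thesis
        using b[of c] norm_triangle_sub[of z c] by (simp add: dist_norm norm_minus_commute)
    qed
    then have "bounded (U 0)" unfolding bounded_iff by blast
    then have F: "finite F"
      unfolding F_def
      by (intro finite_cartesian_product config_finite[OF S(1)] config_finite[OF S(2)]
          bounded_fst bounded_snd)
    have dec: "U n \<subseteq> U m" if "m \<le> n" for m n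
    proof -
      have "inverse (real (Suc n)) \<le> inverse (real (Suc m))"
        using that by (simp add: le_imp_inverse_le)
      then show ?thesis unfolding U_def by (intro UN_mono subset_ball) auto
    qed
    show "\<exists>p\<in>S. \<exists>q\<in>S'. (p, q) \<in> C"
    proof (rule ccontr)
      assume no: "\<not> (\<exists>p\<in>S. \<exists>q\<in>S'. (p, q) \<in> C)"
      have "\<exists>n. z \<notin> U n" if z: "z \<notin> C" for z
      proof -
        obtain e where e: "e > 0" "ball z e \<subseteq> - C"
          using C z by (meson ComplI compact_imp_closed open_Compl open_contains_ball)
        obtain n where n: "inverse (real (Suc n)) < e" using reals_Archimedean[OF e(1)] by auto
        have "z \<notin> U n"
        proof
          assume "z \<in> U n"
          then obtain c where c: "c \<in> C" "z \<in> ball c (inverse (real (Suc n)))"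
            unfolding U_def by blast
          then have "c \<in> ball z e" using n by (simp add: dist_commute)
          then show False using c(1) e(2) by blast
        qed
        then show ?thesis by blast
      qed
      \<comment> \<open>Each pair in \<open>F\<close> leaves the shrinking neighbourhoods at some
        stage. Beyond the last of these finitely many stages no pair is left, although
        \<open>hit\<close> provides one.\<close>
      then obtain n where n: "\<And>z. z \<notin> C \<Longrightarrow> z \<notin> U (n z)" by metis
      define m where "m = Max (insert 0 (n ` F))"
      have le: "n z \<le> m" if "z \<in> F" for z unfolding m_def using F that by auto
      obtain p q where pq: "p \<in> S" "q \<in> S'" "(p, q) \<in> U m" using hit by blast
      then have "(p, q) \<in> U 0" using dec[of 0 m] by auto
      then have "(p, q) \<in> F"
        using pq unfolding F_def by (auto intro: rev_image_eqI)
      then show False using n no pq dec[OF le] by blast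
    qed
  qed
  then have "{\<omega> \<in> space M. \<exists>p\<in>N \<omega>. \<exists>q\<in>N' \<omega>. (p, q) \<in> C} =
     {\<omega> \<in> space M. \<forall>n. \<exists>p\<in>N \<omega>. \<exists>q\<in>N' \<omega>. (p, q) \<in> U n}"
    using measurable_space[OF N(1)] measurable_space[OF N(2)]
    by (intro Collect_cong conj_cong refl) simp
  also have "\<dots> \<in> sets M"
    by (intro sets.sets_Collect_countable_All pair_hit_open_sets[OF N Uo])
  finally show ?thesis .
qed


subsection \<open>The cylinder field\<close>

text \<open>\<open>direction \<theta>\<close> is the unit normal of the line. The orthogonal
  projection \<open>?y\<close> attains the value, and Cauchy-Schwarz shows that no point of the line
  is closer.\<close>

lemma infdist_line: "infdist x (line \<theta> t) = \<bar>x \<bullet> direction \<theta> - t\<bar>"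
proof -
  let ?d = "direction \<theta>"
  have d: "?d \<bullet> ?d = 1" by (simp add: direction_def power2_eq_square[symmetric])
  then have nd: "norm ?d = 1" by (simp add: norm_eq_sqrt_inner)
  have mem: "y \<in> line \<theta> t \<longleftrightarrow> y \<bullet> ?d = t" for y
    by (simp add: line_def orthogonal_def inner_diff_left d)
  let ?y = "x - (x \<bullet> ?d - t) *\<^sub>R ?d"
  have y: "?y \<in> line \<theta> t" by (simp add: mem inner_diff_left d)
  have "infdist x (line \<theta> t) \<le> dist x ?y" by (rule infdist_le[OF y])
  also have "\<dots> = \<bar>x \<bullet> ?d - t\<bar>" by (simp add: dist_norm nd)
  finally have 1: "infdist x (line \<theta> t) \<le> \<bar>x \<bullet> ?d - t\<bar>" .
  have "\<bar>x \<bullet> ?d - t\<bar> \<le> dist x z" if "z \<in> line \<theta> t" for z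
  proof -
    have "x \<bullet> ?d - t = (x - z) \<bullet> ?d" using that by (simp add: mem inner_diff_left)
    also have "\<bar>\<dots>\<bar> \<le> norm (x - z) * norm ?d" by (rule Cauchy_Schwarz_ineq2)
    finally show ?thesis by (simp add: nd dist_norm)
  qed
  then have "\<bar>x \<bullet> ?d - t\<bar> \<le> infdist x (line \<theta> t)"
    unfolding infdist_def using y by (auto intro!: cINF_greatest)
  with 1 show ?thesis by simp
qed

lemma mem_cylinder_union:
  "x \<in> cylinder_union r S \<longleftrightarrow> (\<exists>(\<theta>, t)\<in>S. \<bar>x \<bullet> direction \<theta> - t\<bar> \<le> r)"
  by (auto simp: cylinder_union_def cylinder_def infdist_line)

lemma norm_direction: "norm (direction \<theta>) = 1"
  by (simp add: direction_def norm_Pair)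

lemma continuous_on_direction [continuous_intros]:
  fixes f :: "'a::t2_space \<Rightarrow> real"
  shows "continuous_on A f \<Longrightarrow> continuous_on A (\<lambda>x. direction (f x))"
  unfolding direction_def by (intro continuous_intros)

lemma inner_direction_le: "\<bar>x \<bullet> direction \<theta>\<bar> \<le> norm x"
  using Cauchy_Schwarz_ineq2[of x "direction \<theta>"] by (simp add: norm_direction)

text \<open>Only finitely many cylinders of a locally finite configuration meet a unit ball, so a
  point outside all of them has a neighbourhood outside all of them.\<close>

lemma closed_cylinder_union:
  assumes S: "S \<in> configurations line_params"
  shows "closed (cylinder_union r S)"
proof -
  have "\<exists>T. open T \<and> x \<in> T \<and> T \<subseteq> - cylinder_union r S" if x: "x \<notin> cylinder_union r S" for x
  proof -
    define F where "F = S \<inter> ({0..2*pi} \<times> {0..norm x + 1 + r})"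
    have fin: "finite F" unfolding F_def
      by (rule config_finite[OF S]) (auto intro!: bounded_Times)
    define T where "T = ball x 1 \<inter> (\<Inter>(\<theta>, t)\<in>F. {y. \<bar>y \<bullet> direction \<theta> - t\<bar> > r})"
    have "open T" unfolding T_def using fin
      by (auto intro!: open_Int open_INT open_Collect_less continuous_intros)
    moreover have "x \<in> T" using x by (auto simp: T_def F_def mem_cylinder_union)
    moreover have "y \<notin> cylinder_union r S" if "y \<in> T" for y
    proof
      assume "y \<in> cylinder_union r S"
      then obtain \<theta> t where l: "(\<theta>, t) \<in> S" "\<bar>y \<bullet> direction \<theta> - t\<bar> \<le> r"
        by (auto simp: mem_cylinder_union)
      have "norm y \<le> norm x + 1"
        using that norm_triangle_sub[of y x] by (auto simp: T_def dist_norm norm_minus_commute)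
      then have "t \<le> norm x + 1 + r" using l(2) inner_direction_le[of y \<theta>] by linarith
      moreover have "\<theta> \<in> {0..2*pi}" "t \<ge> 0"
        using S l(1) by (auto simp: configurations_def line_params_def)
      ultimately have "(\<theta>, t) \<in> F" using l(1) by (auto simp: F_def)
      then show False using that l(2) by (auto simp: T_def)
    qed
    ultimately show ?thesis by blast
  qed
  then have "open (- cylinder_union r S)" by (subst open_subopen) blast
  then show ?thesis by (simp add: closed_def)
qed

section \<open>Covering of the segment as a countable condition\<close>

text \<open>
  Off the cylinders the grains are single points, which are too sparse to fill a hole left by the
  unit discs; as the union of these discs is closed, rational points suffice.
\<close>

lemma segment_covered_iff:
  assumes S: "S \<in> configurations marked_plane" and "s > 0"
    and f: "f = cylinder_field 2 Y"
  shows "closed_segment (0, 0) (s, 0) \<subseteq> field_boolean S f \<longleftrightarrow>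
    (\<forall>q\<in>\<rat> \<inter> {0..s}. \<exists>(x, z)\<in>S. x \<in> cylinder_union 2 Y \<and> dist x (q, 0) \<le> 1)"
    (is "?L \<longleftrightarrow> ?R")
proof -
  let ?U = "cylinder_union 2 Y"
  have seg: "closed_segment (0, 0) (s, 0) = (\<lambda>t. (t, 0)) ` {0..s}"
  proof -
    have "closed_segment (0, 0) (s, 0) = (\<lambda>t. (t, 0)) ` ((\<lambda>u. u * s) ` {0..1})"
      by (auto simp: closed_segment_def image_image)
    also have "(\<lambda>u. u * s) ` {0..1} = {0..s}"
      using \<open>s > 0\<close> by (simp add: image_mult_atLeastAtMost_if mult.commute[of _ s])
    finally show ?thesis .
  qed
  \<comment> \<open>The finitely many points of \<open>S\<close> whose grain, of radius at most 1,
    can reach the segment.\<close>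
  define F where "F = S \<inter> (cball 0 (s + 1) \<times> {0..1})"
  have fin: "finite F" unfolding F_def
    by (rule config_finite[OF S]) (auto intro!: bounded_Times)
  have inF: "(x, z) \<in> F" if "(x, z) \<in> S" "dist x (t, 0) \<le> 1" "t \<in> {0..s}" for x z t
  proof -
    have "norm x \<le> norm (t, 0::real) + dist x (t, 0)"
      by (metis dist_norm norm_triangle_sub)
    also have "\<dots> \<le> s + 1" using that by (simp add: norm_Pair)
    finally show ?thesis using that S by (auto simp: F_def configurations_def marked_plane_def)
  qed
  \<comment> \<open>Positions covered by a genuine unit disc: a finite union of closed sets.
    Whatever else is covered is covered by its own radius-0 grain.\<close>
  define K where "K = {t. \<exists>(x, z)\<in>F. x \<in> ?U \<and> dist x (t, 0::real) \<le> 1}"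
  have "K = (\<Union>(x, z)\<in>{(x, z)\<in>F. x \<in> ?U}. {t. dist x (t, 0) \<le> 1})"
    unfolding K_def by auto
  also have "closed \<dots>"
    using fin by (auto intro!: closed_UN closed_Collect_le continuous_intros elim!: rev_finite_subset)
  finally have K: "closed K" .
  have K_iff: "(\<exists>(x, z)\<in>S. x \<in> ?U \<and> dist x (t, 0) \<le> 1) \<longleftrightarrow> t \<in> K" if "t \<in> {0..s}" for t
    using inF[OF _ _ that] unfolding K_def by (fastforce simp: F_def)
  have cov: "(t, 0) \<in> field_boolean S f \<longleftrightarrow> t \<in> K \<or> (t, 0) \<in> fst ` F" if t: "t \<in> {0..s}" for t
  proof -
    have "dist x y \<le> f x \<longleftrightarrow> x \<in> ?U \<and> dist x y \<le> 1 \<or> x \<notin> ?U \<and> x = y" for x y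
      by (cases "x \<in> ?U") (simp_all add: f cylinder_field_def)
    then have "(t, 0) \<in> field_boolean S f \<longleftrightarrow>
        (\<exists>(x, z)\<in>S. x \<in> ?U \<and> dist x (t, 0) \<le> 1) \<or> (\<exists>(x, z)\<in>S. x \<notin> ?U \<and> x = (t, 0))"
      by (simp only: field_boolean_def UN_iff mem_cball case_prod_unfold bex_disj_distrib)
    also have "(\<exists>(x, z)\<in>S. x \<notin> ?U \<and> x = (t, 0)) \<longleftrightarrow> (t, 0) \<notin> ?U \<and> (\<exists>z. ((t, 0), z) \<in> S)"
      by auto
    finally have *: "(t, 0) \<in> field_boolean S f \<longleftrightarrow>
        t \<in> K \<or> (t, 0) \<notin> ?U \<and> (\<exists>z. ((t, 0), z) \<in> S)"
      using K_iff[OF t] by simp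
    have F: "(t, 0) \<in> fst ` F \<longleftrightarrow> (\<exists>z. ((t, 0), z) \<in> S)"
      using inF[of "(t, 0)" _ t] t by (force simp: F_def)
    have "t \<in> K" if "((t, 0), z) \<in> S" "(t, 0) \<in> ?U" for z
    proof -
      have "\<exists>(x, z)\<in>S. x \<in> ?U \<and> dist x (t, 0) \<le> 1"
        using that by (intro bexI[of _ "((t, 0), z)"]) auto
      then show ?thesis using K_iff[OF t] by simp
    qed
    then show ?thesis using * F by blast
  qed
  have L: "?L \<longleftrightarrow> (\<forall>t\<in>{0..s}. t \<in> K \<or> (t, 0) \<in> fst ` F)"
    unfolding seg using cov by auto
  have R: "?R \<longleftrightarrow> \<rat> \<inter> {0..s} \<subseteq> K"
    using K_iff by auto
  have fin': "finite {t. (t, 0) \<in> fst ` F}"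
    using finite_vimageI[OF finite_imageI[OF fin, of fst], of "\<lambda>t. (t, 0)"]
    by (simp add: inj_on_def vimage_def)
  show ?thesis unfolding L R
  proof
    assume *: "\<forall>t\<in>{0..s}. t \<in> K \<or> (t, 0) \<in> fst ` F"
    have "{0..s} \<subseteq> K"
    proof (rule ccontr)
      assume "\<not> {0..s} \<subseteq> K"
      then obtain t where t: "t \<in> {0..s}" "t \<notin> K" by blast
      obtain e where e: "e > 0" "ball t e \<subseteq> - K"
        using K t(2) by (meson ComplI open_Compl open_contains_ball)
      \<comment> \<open>Near an uncovered \<open>t\<close> the closed set \<open>K\<close> is missed
        on a whole interval, so all points of this interval would be centers of grains, of which
        there are finitely many.\<close>
      have "{max 0 (t - e)<..<min s (t + e)} \<subseteq> {t. (t, 0) \<in> fst ` F}"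
      proof
        fix r assume "r \<in> {max 0 (t - e)<..<min s (t + e)}"
        then have "r \<in> {0..s}" "r \<in> ball t e" by (auto simp: dist_real_def)
        then show "r \<in> {t. (t, 0) \<in> fst ` F}" using * e by blast
      qed
      then have "finite {max 0 (t - e)<..<min s (t + e)}" using fin' finite_subset by blast
      moreover have "infinite {max 0 (t - e)<..<min s (t + e)}"
        by (rule infinite_Ioo) (use t e \<open>s > 0\<close> in auto)
      ultimately show False by simp
    qed
    then show "\<rat> \<inter> {0..s} \<subseteq> K" by auto
  next
    assume *: "\<rat> \<inter> {0..s} \<subseteq> K"
    \<comment> \<open>Density of the rationals is used on the open interval, where the complement of
      \<open>K\<close> is open; the end points, possibly irrational, follow by closure.\<close>
    have "{0<..<s} \<subseteq> K"
    proof (rule ccontr)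
      assume "\<not> {0<..<s} \<subseteq> K"
      then have "{0<..<s} - K \<noteq> {}" by auto
      moreover have "open ({0<..<s} - K)" using K by (intro open_Diff) auto
      ultimately obtain a where a: "a \<in> {0<..<s} - K" "open ({0<..<s} - K)" by blast
      then obtain e where e: "e > 0" "ball a e \<subseteq> {0<..<s} - K"
        using open_contains_ball by blast
      obtain q where q: "q \<in> \<rat>" "a < q" "q < a + e"
        using Rats_dense_in_real[of a "a + e"] e(1) by auto
      then have "q \<in> ball a e" by (simp add: dist_real_def)
      then have "q \<in> {0<..<s} - K" using e(2) by blast
      then show False using * q(1) by auto
    qed
    then have "closure {0<..<s} \<subseteq> K" using K by (rule closure_minimal)
    then show "\<forall>t\<in>{0..s}. t \<in> K \<or> (t, 0) \<in> fst ` F"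
      using \<open>s > 0\<close> by auto
  qed
qed

text \<open>A countable intersection, over rational points of the segment, of events that a disc
  center and a line form a pair in a compact set. A non-measurable set would have measure 0, so the
  lower bound for this event rests on it.\<close>

lemma segment_covered_sets:
  assumes N: "N \<in> measurable M (config_space marked_plane)"
    and X: "X \<in> measurable M (config_space line_params)" and "s > 0"
  shows "{\<omega> \<in> space M. closed_segment (0, 0) (s, 0) \<subseteq>
      field_boolean (N \<omega>) (cylinder_field 2 (X \<omega>))} \<in> sets M"
proof -
  \<comment> \<open>Closing the angle range and truncating \<open>t\<close> makes the set compact
    and loses no pair: a center within 1 of \<open>(q, 0)\<close> has norm at most
    \<open>q + 1\<close>, hence \<open>t \<le> q + 3\<close>.\<close>
  define C where "C q = {((x, z), (\<theta>, t)) | x (z :: real) \<theta> t. dist x (q, 0) \<le> 1 \<and> z \<in> {0..1} \<and>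
      \<theta> \<in> {0..2 * pi} \<and> t \<in> {0..q + 4} \<and> \<bar>x \<bullet> direction \<theta> - t\<bar> \<le> 2}" for q :: real
  have C: "compact (C q)" for q
  proof -
    have "C q = ((cball (q, 0) 1 \<times> {0..1}) \<times> ({0..2 * pi} \<times> {0..q + 4})) \<inter>
        {p. \<bar>fst (fst p) \<bullet> direction (fst (snd p)) - snd (snd p)\<bar> \<le> 2}"
      unfolding C_def by (auto simp: dist_commute)
    also have "compact \<dots>"
      by (intro compact_Int_closed compact_Times compact_cball compact_Icc closed_Collect_le
          continuous_intros)
    finally show ?thesis .
  qed
  have "(\<exists>(x, z)\<in>S. x \<in> cylinder_union 2 Y \<and> dist x (q, 0) \<le> 1) \<longleftrightarrow> (\<exists>p\<in>S. \<exists>l\<in>Y. (p, l) \<in> C q)"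
    if S: "S \<in> configurations marked_plane" "Y \<in> configurations line_params" and "q \<ge> 0" for S Y q
  proof
    assume "\<exists>(x, z)\<in>S. x \<in> cylinder_union 2 Y \<and> dist x (q, 0) \<le> 1"
    then obtain x z \<theta> t where *: "(x, z) \<in> S" "(\<theta>, t) \<in> Y" "dist x (q, 0) \<le> 1"
        "\<bar>x \<bullet> direction \<theta> - t\<bar> \<le> 2"
      by (auto simp: mem_cylinder_union)
    have "norm x \<le> norm (q, 0::real) + dist x (q, 0)"
      by (metis dist_norm norm_triangle_sub)
    then have "norm x \<le> q + 1" using * \<open>q \<ge> 0\<close> by (simp add: norm_Pair)
    then have "t \<le> q + 4" using *(4) inner_direction_le[of x \<theta>] by linarith
    then have "((x, z), (\<theta>, t)) \<in> C q"
      using * S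
      by (cases x) (auto simp: C_def configurations_def marked_plane_def line_params_def)
    then show "\<exists>p\<in>S. \<exists>l\<in>Y. (p, l) \<in> C q" using * by blast
  next
    assume "\<exists>p\<in>S. \<exists>l\<in>Y. (p, l) \<in> C q"
    then show "\<exists>(x, z)\<in>S. x \<in> cylinder_union 2 Y \<and> dist x (q, 0) \<le> 1"
      by (force simp: C_def mem_cylinder_union)
  qed
  then have "{\<omega> \<in> space M. closed_segment (0, 0) (s, 0) \<subseteq>
      field_boolean (N \<omega>) (cylinder_field 2 (X \<omega>))} =
    {\<omega> \<in> space M. \<forall>q\<in>\<rat> \<inter> {0..s}. \<exists>p\<in>N \<omega>. \<exists>l\<in>X \<omega>. (p, l) \<in> C q}"
    using measurable_space[OF N] measurable_space[OF X]
    by (intro Collect_cong conj_cong refl) (simp add: segment_covered_iff[OF _ \<open>s > 0\<close> refl])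
  also have "\<dots> \<in> sets M"
    by (intro sets.sets_Collect_countable_All' pair_hit_compact_sets[OF N X C] countable_Int1 countable_rat)
  finally show ?thesis .
qed


subsection \<open>Covering probabilities\<close>

lemma measure_lborel_Times:
  fixes A :: "'a::euclidean_space set" and B :: "'b::euclidean_space set"
  assumes "A \<in> sets borel" "B \<in> sets borel"
  shows "measure lborel (A \<times> B) = measure lborel A * measure lborel B"
  unfolding lborel_prod[symmetric] measure_def using assms
  by (simp add: lborel.emeasure_pair_measure_Times enn2real_mult)

text \<open>\<open>F\<close> is the distribution function with mass \<open>p\<close> at 0 and the
  rest at 1 if \<open>p\<close> is a probability. The level set is a closed half-line:
  \<open>0 < z\<close> bounds it from below and \<open>z \<le> 1\<close> makes it nonempty.\<close>

lemma quantile_two_step: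
  assumes F: "\<And>x. F x = (if x < 0 then 0 else if x < 1 then p else 1)" and z: "0 < z" "z \<le> 1"
  shows "quantile F z = (if z \<le> p then 0 else 1)"
proof (cases "z \<le> p")
  case True
  then have "{x. F x \<ge> z} = {0..}" using F z by auto
  then show ?thesis using True by (simp add: quantile_def)
next
  case False
  then have "{x. F x \<ge> z} = {1..}" using F z by auto
  then show ?thesis using False by (simp add: quantile_def)
qed

section \<open>Marginal law of the field and upper bound in the independent model\<close>

context prob_space
begin

text \<open>The origin has distance \<open>t\<close> from its line with parameters
  \<open>(\<theta>, t)\<close>, so it lies in a cylinder exactly if a parameter falls in the
  rectangle \<open>?R\<close> of area \<open>4 * pi\<close>.\<close>

lemma marginal_cdf_cylinder_field:
  assumes P: "poisson_process M line_params u X" and "u \<ge> 0"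
  shows "marginal_cdf M (\<lambda>\<omega>. cylinder_field 2 (X \<omega>)) x =
    (if x < 0 then 0 else if x < 1 then exp (- (4 * pi * u)) else 1)"
proof -
  let ?R = "{0..<2 * pi} \<times> {0..2::real}"
  define H where "H = {\<omega> \<in> space M. X \<omega> \<inter> ?R \<noteq> {}}"
  have X: "X \<in> measurable M (config_space line_params)" using P by (simp add: poisson_process_def)
  have R: "?R \<in> sets borel" "bounded ?R"
    by (auto intro!: bounded_Times borel_Times)
  have H: "H \<in> events" unfolding H_def by (rule hit_sets[OF X R])
  have "?R \<inter> line_params = ?R" by (auto simp: line_params_def)
  then have "prob H = 1 - exp (- (4 * pi * u))"
    unfolding H_def prob_hit[OF P \<open>u \<ge> 0\<close> R] by (simp add: measure_lborel_Times mult_ac)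
  then have compl: "prob (space M - H) = exp (- (4 * pi * u))"
    using prob_compl[OF H] by simp
  have field: "cylinder_field 2 (X \<omega>) 0 = indicator H \<omega>" if "\<omega> \<in> space M" for \<omega>
  proof -
    have "X \<omega> \<subseteq> line_params"
      using measurable_space[OF X that] by (auto simp: configurations_def)
    then have "\<bar>0 \<bullet> direction \<theta> - t\<bar> \<le> 2 \<longleftrightarrow> (\<theta>, t) \<in> ?R" if "(\<theta>, t) \<in> X \<omega>" for \<theta> t
      using that by (auto simp: line_params_def)
    then have "0 \<in> cylinder_union 2 (X \<omega>) \<longleftrightarrow> (\<exists>l\<in>X \<omega>. l \<in> ?R)"
      unfolding mem_cylinder_union by (intro bex_cong refl) (clarsimp simp only: split_paired_all prod.case)
    then have "0 \<in> cylinder_union 2 (X \<omega>) \<longleftrightarrow> \<omega> \<in> H"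
      using that unfolding H_def by blast
    then show ?thesis by (simp add: cylinder_field_def indicator_def)
  qed
  have meas: "(\<lambda>\<omega>. cylinder_field 2 (X \<omega>) 0) \<in> borel_measurable M"
    using H by (subst measurable_cong[OF field]) auto
  have "marginal_cdf M (\<lambda>\<omega>. cylinder_field 2 (X \<omega>)) x =
      prob ((\<lambda>\<omega>. cylinder_field 2 (X \<omega>) 0) -` {..x} \<inter> space M)"
    unfolding marginal_cdf_def cdf_def by (rule measure_distr[OF meas]) auto
  also have "(\<lambda>\<omega>. cylinder_field 2 (X \<omega>) 0) -` {..x} \<inter> space M = {\<omega> \<in> space M. indicator H \<omega> \<le> x}"
    using field by auto
  also have "\<dots> = (if x < 0 then {} else if x < 1 then space M - H else space M)"
    by (auto simp: indicator_def split: if_splits)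
  finally show ?thesis using compl by (simp add: prob_space)
qed

text \<open>
  The unit discs around the points \<open>(3 i, 0)\<close> are disjoint, which gives independence. Points of mark
  \<open>0\<close>, where the quantile is unspecified, and points at some \<open>(3 i, 0)\<close> are almost surely absent.
\<close>

lemma prob_iid_boolean_le:
  assumes P: "poisson_process M marked_plane lam N" "lam \<ge> 0"
    and F: "\<And>x. F x = (if x < 0 then 0 else if x < 1 then p else 1)" and p: "0 \<le> p" "p < 1"
    and n: "3 * (real n - 1) \<le> s" "s > 0"
  shows "prob {\<omega> \<in> space M. closed_segment (0, 0) (s, 0) \<subseteq> iid_boolean (N \<omega>) F}
    \<le> (4 * lam * (1 - p)) ^ n"
proof -
  \<comment> \<open>A square around the unit disc at \<open>(3 i, 0)\<close>, times the marks with
    quantile 1. Squares have side 2 and spacing 3, so they are disjoint; each box has volume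
    \<open>4 * (1 - p)\<close>.\<close>
  define A :: "nat \<Rightarrow> (plane \<times> real) set" where
    "A i = ({3 * real i - 1..3 * real i + 1} \<times> {-1..1}) \<times> {p<..1}" for i
  \<comment> \<open>Whatever real number \<open>quantile F 0\<close> is, a grain of mark 0 that
    reaches some \<open>(3 i, 0)\<close> in the segment has its center within \<open>c\<close> of
    the origin. Hence the null set \<open>Z\<close> is bounded.\<close>
  define c where "c = s + \<bar>quantile F 0\<bar>"
  define Z :: "(plane \<times> real) set" where "Z = cball 0 c \<times> {0}"
  \<comment> \<open>Positive marks up to \<open>p\<close> give radius 0, so such a grain covers
    \<open>(3 i, 0)\<close> only if it is centered there.\<close>
  define Y :: "(plane \<times> real) set" where "Y = (\<lambda>i. (3 * real i, 0)) ` {..<n} \<times> {0..1}"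
  have N: "N \<in> measurable M (config_space marked_plane)" using P by (simp add: poisson_process_def)
  have hitA: "prob {\<omega> \<in> space M. \<forall>i\<in>{..<n}. N \<omega> \<inter> A i \<noteq> {}} =
      (1 - exp (- (lam * (4 * (1 - p))))) ^ card {..<n}"
  proof (rule prob_hit_family[OF P])
    show "disjoint_family_on A {..<n}"
    proof (unfold disjoint_family_on_def, intro ballI impI)
      fix i j :: nat assume "i \<noteq> j"
      then have "\<bar>real i - real j\<bar> \<ge> 1" by auto
      then show "A i \<inter> A j = {}" by (auto simp: A_def abs_if split: if_splits)
    qed
    fix i
    have "A i \<inter> marked_plane = A i" using p by (auto simp: A_def marked_plane_def)
    then show "A i \<in> sets borel \<and> bounded (A i) \<and> A i \<noteq> {} \<and>
        measure lborel (A i \<inter> marked_plane) = 4 * (1 - p)"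
      using p by (auto simp: A_def measure_lborel_Times borel_Times intro!: bounded_Times)
  qed auto
  have Z: "Z \<in> sets borel" "bounded Z" "measure lborel (Z \<inter> marked_plane) = 0"
  proof -
    have "Z \<inter> marked_plane = Z" by (auto simp: Z_def marked_plane_def)
    then show "measure lborel (Z \<inter> marked_plane) = 0"
      by (simp add: Z_def measure_lborel_Times)
  qed (auto simp: Z_def borel_Times intro!: bounded_Times)
  have Y: "Y \<in> sets borel" "bounded Y" "measure lborel (Y \<inter> marked_plane) = 0"
  proof -
    have fin: "finite ((\<lambda>i. (3 * real i, 0::real)) ` {..<n})" by simp
    show "Y \<in> sets borel" "bounded Y"
      unfolding Y_def using borel_closed[OF finite_imp_closed[OF fin]] finite_imp_bounded[OF fin]
      by (simp_all add: borel_Times bounded_Times)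
    have "Y \<inter> marked_plane = Y" by (auto simp: Y_def marked_plane_def)
    moreover have "measure lborel ((\<lambda>i. (3 * real i, 0::real)) ` {..<n}) = 0"
      using finite_imp_null_set_lborel[OF fin] by (auto simp: null_sets_def measure_def)
    ultimately show "measure lborel (Y \<inter> marked_plane) = 0"
      using borel_closed[OF finite_imp_closed[OF fin]] by (simp add: Y_def measure_lborel_Times)
  qed
  let ?HA = "{\<omega> \<in> space M. \<forall>i\<in>{..<n}. N \<omega> \<inter> A i \<noteq> {}}"
  let ?HZ = "{\<omega> \<in> space M. N \<omega> \<inter> Z \<noteq> {}}" and ?HY = "{\<omega> \<in> space M. N \<omega> \<inter> Y \<noteq> {}}"
  have sub: "{\<omega> \<in> space M. closed_segment (0, 0) (s, 0) \<subseteq> iid_boolean (N \<omega>) F} \<subseteq> ?HA \<union> ?HZ \<union> ?HY"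
  proof safe
    fix \<omega> i
    assume \<omega>: "\<omega> \<in> space M" and cov: "closed_segment (0, 0) (s, 0) \<subseteq> iid_boolean (N \<omega>) F"
      and noZ: "N \<omega> \<inter> Z = {}" and noY: "N \<omega> \<inter> Y = {}" and "i < n" and noA: "N \<omega> \<inter> A i = {}"
    have "real (Suc i) \<le> real n" using \<open>i < n\<close> by (simp only: of_nat_le_iff Suc_leI)
    then have i: "3 * real i \<le> s" using n by simp
    have "(3 * real i, 0) \<in> closed_segment (0, 0) (s, 0)"
      using i \<open>s > 0\<close> by (auto simp: in_segment intro!: exI[of _ "3 * real i / s"])
    then obtain x z where xz: "(x, z) \<in> N \<omega>" "dist x (3 * real i, 0) \<le> quantile F z"
      using cov unfolding iid_boolean_def by auto
    have z: "0 \<le> z" "z \<le> 1"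
      using xz(1) measurable_space[OF N \<omega>] by (auto simp: configurations_def marked_plane_def)
    consider "z = 0" | "0 < z" "z \<le> p" | "p < z" using z by linarith
    then show False
    proof cases
      case 1
      have "norm x \<le> norm (3 * real i, 0::real) + dist x (3 * real i, 0)"
        by (metis dist_norm norm_triangle_sub)
      also have "\<dots> \<le> c" using xz(2) 1 i by (simp add: c_def)
      finally have "(x, z) \<in> Z" using 1 by (simp add: Z_def)
      then show False using noZ xz by auto
    next
      case 2
      then have "x = (3 * real i, 0)" using xz(2) quantile_two_step[OF F 2(1) z(2)] by simp
      then have "(x, z) \<in> Y" using z \<open>i < n\<close> by (auto simp: Y_def)
      then show False using noY xz by auto
    next
      case 3
      then have d: "dist x (3 * real i, 0) \<le> 1"
        using xz(2) p quantile_two_step[OF F _ z(2)] by simp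
      have "\<bar>fst x - 3 * real i\<bar> \<le> 1" "\<bar>snd x\<bar> \<le> 1"
        using dist_fst_le[of x "(3 * real i, 0)"] dist_snd_le[of x "(3 * real i, 0)"] d
        by (auto simp: dist_real_def)
      then have "(x, z) \<in> A i" using 3 z by (cases x) (auto simp: A_def)
      then show False using noA xz by auto
    qed
  qed
  have sets: "?HA \<in> events" "?HZ \<in> events" "?HY \<in> events"
  proof -
    show "?HZ \<in> events" "?HY \<in> events" using hit_sets[OF N] Z Y by auto
    have "{\<omega> \<in> space M. N \<omega> \<inter> A i \<noteq> {}} \<in> events" for i
      by (rule hit_sets[OF N]) (auto simp: A_def borel_Times intro!: bounded_Times)
    then show "?HA \<in> events" by (intro sets.sets_Collect_finite_All) auto
  qed
  \<comment> \<open>Monotonicity is applied with measurability of the larger event, the union of the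
    three hitting events.\<close>
  have "prob {\<omega> \<in> space M. closed_segment (0, 0) (s, 0) \<subseteq> iid_boolean (N \<omega>) F}
      \<le> prob (?HA \<union> ?HZ \<union> ?HY)"
    using sets by (intro finite_measure_mono[OF sub]) auto
  also have "\<dots> \<le> prob ?HA + prob ?HZ + prob ?HY"
    using measure_Un_le[OF sets(1,2)] measure_Un_le[OF sets.Un[OF sets(1,2)] sets(3)]
    by linarith
  also have "\<dots> = (1 - exp (- (lam * (4 * (1 - p))))) ^ n"
    using hitA prob_hit[OF P Z(1,2)] prob_hit[OF P Y(1,2)] Z(3) Y(3) by simp
  \<comment> \<open>This is \<open>1 - exp (- x) \<le> x\<close>.\<close>
  also have "\<dots> \<le> (4 * lam * (1 - p)) ^ n"
    using exp_ge_add_one_self[of "- (lam * (4 * (1 - p)))"] P(2) p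
    by (intro power_mono) (auto simp: mult_ac)
  finally show ?thesis .
qed

section \<open>Lower bound in the cylinder field\<close>

text \<open>
  A single line close to the segment turns on a whole strip around it, at a probability cost that
  is only polynomial in the length of the segment.
\<close>

lemma prob_field_boolean_ge:
  assumes P: "poisson_process M marked_plane lam N" "lam \<ge> 0"
    and PX: "poisson_process M line_params u X" "u \<ge> 0"
    and ind: "field_independent M N (\<lambda>\<omega>. cylinder_field 2 (X \<omega>))"
    and n: "s < 3 * real n" "s > 0"
  shows "(1 - exp (- (u / (3 * real n)))) * ((1 - exp (- (lam / 4))) ^ 6) ^ n \<le>
    prob {\<omega> \<in> space M. closed_segment (0, 0) (s, 0) \<subseteq> field_boolean (N \<omega>) (cylinder_field 2 (X \<omega>))}"
proof -
  let ?\<phi> = "\<lambda>\<omega>. cylinder_field 2 (X \<omega>)"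
  let ?S\<eta> = "vimage_algebra (space M) N (config_space marked_plane)"
  let ?S\<phi> = "vimage_algebra (space M) ?\<phi> (\<Pi>\<^sub>M x\<in>UNIV. borel)"
  have N: "N \<in> measurable M (config_space marked_plane)"
    and X: "X \<in> measurable M (config_space line_params)"
    using P PX by (auto simp: poisson_process_def)
  have "n > 0" using n by (cases n) auto
  \<comment> \<open>The squares of side 1/2 lined up above the segment. A point of the segment is
    within 1/2 horizontally and 1/2 vertically of every point in the square above it, so one center
    per square suffices; \<open>6 * n\<close> squares reach up to \<open>3 * n\<close>.\<close>
  define Q :: "nat \<Rightarrow> (plane \<times> real) set" where
    "Q i = ({real i / 2<..<(real i + 1) / 2} \<times> {0<..<1/2}) \<times> {0..1}" for i
  define W :: "plane set" where "W = {0<..<3 * real n} \<times> {0<..<1/2}"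
  have "open W" unfolding W_def by (intro open_Times) auto
  \<comment> \<open>Independence concerns events generated by the values of the field, not by the
    lines. A countable dense set expresses that the strip \<open>W\<close> is switched on by
    countably many such values.\<close>
  obtain T :: "plane set" where T: "countable T" "\<And>V. open V \<Longrightarrow> V \<noteq> {} \<Longrightarrow> \<exists>d\<in>T. d \<in> V"
    using countable_dense_setE by blast
  define E where "E = {\<omega> \<in> space M. \<forall>i\<in>{..<6 * n}. N \<omega> \<inter> Q i \<noteq> {}}"
  define D where "D = {\<omega> \<in> space M. \<forall>x\<in>T \<inter> W. ?\<phi> \<omega> x = 1}"
  \<comment> \<open>Lines almost parallel to the first axis and close to it; the area of this
    parameter set is \<open>1 / (3 * n)\<close>.\<close>
  define B where "B = {pi / 2 - 1 / (3 * real n)..pi / 2} \<times> {0..1::real}"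
  have small: "1 / (3 * real n) \<le> 1" using \<open>n > 0\<close> by simp
  have N': "N \<in> measurable ?S\<eta> (config_space marked_plane)"
    using measurable_space[OF N] by (intro measurable_vimage_algebra1) auto
  have Qb: "Q i \<in> sets borel" "bounded (Q i)" for i
    by (auto simp: Q_def borel_Times intro!: bounded_Times)
  have E: "E \<in> sets ?S\<eta>"
  proof -
    have "{\<omega> \<in> space ?S\<eta>. \<forall>i\<in>{..<6 * n}. N \<omega> \<inter> Q i \<noteq> {}} \<in> sets ?S\<eta>"
      by (intro sets.sets_Collect_finite_All hit_sets[OF N' Qb]) auto
    then show ?thesis by (simp add: E_def)
  qed
  have D: "D \<in> sets ?S\<phi>"
  proof -
    have \<phi>: "?\<phi> \<in> measurable ?S\<phi> (\<Pi>\<^sub>M x\<in>UNIV. borel)"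
      by (rule measurable_vimage_algebra1) (auto simp: space_PiM)
    have "(\<lambda>\<omega>. ?\<phi> \<omega> x) \<in> borel_measurable ?S\<phi>" for x
      using measurable_compose[OF \<phi> measurable_component_singleton[of x UNIV]] by simp
    then have "{\<omega> \<in> space ?S\<phi>. ?\<phi> \<omega> x = 1} \<in> sets ?S\<phi>" for x
      using borel_measurable_eq[of "\<lambda>\<omega>. ?\<phi> \<omega> x" ?S\<phi> "\<lambda>_. 1"] by simp
    then have "{\<omega> \<in> space ?S\<phi>. \<forall>x\<in>T \<inter> W. ?\<phi> \<omega> x = 1} \<in> sets ?S\<phi>"
      by (intro sets.sets_Collect_countable_All' countable_Int1 T(1))
    then show ?thesis by (simp add: D_def)
  qed
  have indep: "indep_set (sets ?S\<eta>) (sets ?S\<phi>)"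
    using ind by (simp add: field_independent_def)
  have DM: "D \<in> events" using indep_setD_ev2[OF indep] D by blast
  have probE: "prob E = (1 - exp (- (lam * (1/4)))) ^ card {..<6 * n}"
    unfolding E_def
  proof (rule prob_hit_family[OF P])
    show "disjoint_family_on Q {..<6 * n}"
    proof (unfold disjoint_family_on_def, intro ballI impI)
      fix i j :: nat assume "i \<noteq> j"
      then have "\<bar>real i - real j\<bar> \<ge> 1" by auto
      then show "Q i \<inter> Q j = {}" by (auto simp: Q_def abs_if split: if_splits)
    qed
    fix i
    have "Q i \<inter> marked_plane = Q i" by (auto simp: Q_def marked_plane_def)
    moreover have "((real i / 2 + 1 / 4, 1 / 4), 1) \<in> Q i" by (auto simp: Q_def field_simps)
    ultimately show "Q i \<in> sets borel \<and> bounded (Q i) \<and> Q i \<noteq> {} \<and>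
        measure lborel (Q i \<inter> marked_plane) = 1/4"
      using Qb by (auto simp: Q_def measure_lborel_Times borel_Times field_simps)
  qed auto
  have probD: "1 - exp (- (u / (3 * real n))) \<le> prob D"
  proof -
    have B: "B \<in> sets borel" "bounded B" by (auto simp: B_def borel_Times intro!: bounded_Times)
    have "B \<inter> line_params = B"
      using small pi_gt3 by (auto simp: B_def line_params_def)
    then have "1 - exp (- (u / (3 * real n))) = prob {\<omega> \<in> space M. X \<omega> \<inter> B \<noteq> {}}"
      unfolding prob_hit[OF PX B] by (simp add: B_def measure_lborel_Times)
    also have "\<dots> \<le> prob D"
    proof (intro finite_measure_mono DM subsetI)
      fix \<omega> assume "\<omega> \<in> {\<omega> \<in> space M. X \<omega> \<inter> B \<noteq> {}}"
      then obtain \<theta> t where l: "\<omega> \<in> space M" "(\<theta>, t) \<in> X \<omega>" "pi / 2 - 1 / (3 * real n) \<le> \<theta>"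
          "\<theta> \<le> pi / 2" "0 \<le> t" "t \<le> 1"
        by (auto simp: B_def)
      \<comment> \<open>With \<open>cos \<theta> = sin (pi / 2 - \<theta>)\<close> at most
        \<open>1 / (3 * n)\<close>, the horizontal part of the projection stays within 1 along the
        strip. The vertical part is at most 1/2 and \<open>t\<close> at most 1, so the distance is
        below 2.\<close>
      have c: "0 \<le> cos \<theta>" "cos \<theta> \<le> 1 / (3 * real n)"
        using l small pi_gt3 cos_ge_zero[of \<theta>] sin_x_le_x[of "pi / 2 - \<theta>"]
        by (auto simp: cos_sin_eq)
      have "x \<in> cylinder_union 2 (X \<omega>)" if xW: "x \<in> W" for x
      proof -
        obtain a b where x: "x = (a, b)" "0 < a" "a < 3 * real n" "0 < b" "b < 1/2"
          using xW by (cases x) (auto simp: W_def)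
        have "a * cos \<theta> \<le> 3 * real n * (1 / (3 * real n))"
          using c x by (intro mult_mono) auto
        then have "a * cos \<theta> \<le> 1" "0 \<le> a * cos \<theta>" using c x \<open>n > 0\<close> by auto
        moreover have "\<bar>b * sin \<theta>\<bar> \<le> (1/2) * 1"
          unfolding abs_mult using x by (intro mult_mono) auto
        ultimately have "\<bar>x \<bullet> direction \<theta> - t\<bar> \<le> 2"
          using l by (auto simp: x direction_def)
        then show ?thesis using l by (auto simp: mem_cylinder_union)
      qed
      then show "\<omega> \<in> D" using l by (auto simp: D_def cylinder_field_def)
    qed
    finally show ?thesis .
  qed
  have sub: "E \<inter> D \<subseteq>
      {\<omega> \<in> space M. closed_segment (0, 0) (s, 0) \<subseteq> field_boolean (N \<omega>) (?\<phi> \<omega>)}"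
  proof
    fix \<omega> assume "\<omega> \<in> E \<inter> D"
    then have \<omega>: "\<omega> \<in> space M" and e: "\<And>i. i < 6 * n \<Longrightarrow> N \<omega> \<inter> Q i \<noteq> {}"
      and d: "\<And>x. x \<in> T \<inter> W \<Longrightarrow> x \<in> cylinder_union 2 (X \<omega>)"
      by (auto simp: E_def D_def cylinder_field_def indicator_def split: if_splits)
    \<comment> \<open>The part of \<open>W\<close> off the cylinders is open and misses the dense
      set \<open>T\<close>, hence is empty.\<close>
    have "closed (cylinder_union 2 (X \<omega>))"
      using measurable_space[OF X \<omega>] by (intro closed_cylinder_union) auto
    then have "open (W - cylinder_union 2 (X \<omega>))"
      using \<open>open W\<close> by (rule open_Diff[rotated])
    then have W: "W \<subseteq> cylinder_union 2 (X \<omega>)" using T(2) d by blast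
    have "\<exists>(x, z)\<in>N \<omega>. x \<in> cylinder_union 2 (X \<omega>) \<and> dist x (q, 0) \<le> 1" if q: "0 \<le> q" "q \<le> s" for q
    proof -
      define i where "i = nat \<lfloor>2 * q\<rfloor>"
      have i: "real i \<le> 2 * q" "2 * q < real i + 1"
        using q floor_correct[of "2 * q"] by (auto simp: i_def)
      then have "i < 6 * n" using q n by linarith
      then obtain a b z where w: "((a, b), z) \<in> N \<omega>" "((a, b), z) \<in> Q i" using e by fast
      then have ab: "real i / 2 < a" "a < (real i + 1) / 2" "0 < b" "b < 1/2" by (auto simp: Q_def)
      have "real (Suc i) \<le> real (6 * n)"
        using \<open>i < 6 * n\<close> by (simp only: of_nat_le_iff Suc_leI)
      then have "(real i + 1) / 2 \<le> 3 * real n" by simp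
      then have "(a, b) \<in> W" using ab by (auto simp: W_def intro: le_less_trans)
      moreover have "dist (a, b) (q, 0) \<le> \<bar>a - q\<bar> + \<bar>b\<bar>"
        using sqrt_sum_squares_le_sum_abs[of "a - q" b] by (simp add: dist_prod_def dist_real_def)
      then have "dist (a, b) (q, 0) \<le> 1" using ab i by (auto simp: abs_if split: if_splits)
      ultimately show ?thesis using w W by blast
    qed
    then show "\<omega> \<in> {\<omega> \<in> space M. closed_segment (0, 0) (s, 0) \<subseteq> field_boolean (N \<omega>) (?\<phi> \<omega>)}"
      using \<omega> measurable_space[OF N \<omega>] by (simp add: segment_covered_iff[OF _ \<open>s > 0\<close> refl])
  qed
  have "(1 - exp (- (u / (3 * real n)))) * ((1 - exp (- (lam / 4))) ^ 6) ^ n \<le> prob D * prob E"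
    using probD P(2) unfolding probE by (simp add: power_mult mult_right_mono)
  also have "\<dots> = prob (E \<inter> D)" using indep_setD[OF indep E D] by simp
  also have "\<dots> \<le> prob {\<omega> \<in> space M. closed_segment (0, 0) (s, 0) \<subseteq> field_boolean (N \<omega>) (?\<phi> \<omega>)}"
    by (intro finite_measure_mono sub segment_covered_sets N X \<open>s > 0\<close>)
  finally show ?thesis .
qed

end

section \<open>Comparison of the two exponential rates\<close>

theorem proposition8:
  fixes lam :: real
  assumes "lam > 0"
  shows "\<exists>u0>0. \<forall>u. 0 < u \<and> u < u0 \<longrightarrow> (\<exists>s0>0. \<forall>s\<ge>s0.
    \<forall>(M :: 'w measure) (\<eta> :: 'w \<Rightarrow> (plane \<times> real) set) (X :: 'w \<Rightarrow> (real \<times> real) set)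
      (\<phi> :: 'w \<Rightarrow> plane \<Rightarrow> real).
      prob_space M \<and>
      poisson_process M marked_plane lam \<eta> \<and>
      poisson_process M line_params u X \<and>
      \<phi> = (\<lambda>\<omega>. cylinder_field 2 (X \<omega>)) \<and>
      field_independent M \<eta> \<phi> \<longrightarrow>
        measure M {\<omega> \<in> space M. closed_segment (0, 0) (s, 0) \<subseteq> field_boolean (\<eta> \<omega>) (\<phi> \<omega>)}
        > measure M {\<omega> \<in> space M.
            closed_segment (0, 0) (s, 0) \<subseteq> iid_boolean (\<eta> \<omega>) (marginal_cdf M \<phi>)})"
proof -
  \<comment> \<open>Probability that six given squares of the strip are all hit, that is, the
    covering cost per length 3; it does not involve \<open>u\<close>.\<close>
  define b where "b = (1 - exp (- (lam / 4))) ^ 6"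
  have b: "b > 0" using assms by (simp add: b_def)
  \<comment> \<open>Chosen so that
    \<open>4 * lam * (1 - p) \<le> 16 * pi * lam * u \<le> b / 2\<close>: the independent model
    loses a factor of at least 2 for each length 3.\<close>
  define u0 where "u0 = b / (32 * pi * lam)"
  have "u0 > 0" using b assms by (simp add: u0_def)
  moreover have "\<exists>s0>0. \<forall>s\<ge>s0.
    \<forall>(M :: 'w measure) (\<eta> :: 'w \<Rightarrow> (plane \<times> real) set) (X :: 'w \<Rightarrow> (real \<times> real) set)
      (\<phi> :: 'w \<Rightarrow> plane \<Rightarrow> real).
      prob_space M \<and>
      poisson_process M marked_plane lam \<eta> \<and>
      poisson_process M line_params u X \<and>
      \<phi> = (\<lambda>\<omega>. cylinder_field 2 (X \<omega>)) \<and>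
      field_independent M \<eta> \<phi> \<longrightarrow>
        measure M {\<omega> \<in> space M. closed_segment (0, 0) (s, 0) \<subseteq> field_boolean (\<eta> \<omega>) (\<phi> \<omega>)}
        > measure M {\<omega> \<in> space M.
            closed_segment (0, 0) (s, 0) \<subseteq> iid_boolean (\<eta> \<omega>) (marginal_cdf M \<phi>)}"
    if u: "0 < u" "u < u0" for u
  proof -
    \<comment> \<open>This factor \<open>(1/2) ^ n\<close> beats the cost of the line, which is of
      order \<open>u / (3 * n)\<close>. The threshold depends on \<open>u\<close> only, not on the
      probability space.\<close>
    have "eventually (\<lambda>n. (1/2) ^ n < 1 - exp (- (u / (3 * real n)))) sequentially"
      using u(1) by real_asymp
    then obtain n0 where n0: "\<And>n. n \<ge> n0 \<Longrightarrow> (1/2) ^ n < 1 - exp (- (u / (3 * real n)))"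
      by (auto simp: eventually_sequentially)
    define p where "p = exp (- (4 * pi * u))"
    have p: "0 \<le> p" "p < 1" using u by (auto simp: p_def)
    have "1 - p \<le> 4 * pi * u" unfolding p_def using exp_ge_add_one_self[of "- (4 * pi * u)"] by linarith
    then have "4 * lam * (1 - p) \<le> 4 * lam * (4 * pi * u)" using assms by (intro mult_left_mono) auto
    also have "\<dots> \<le> b / 2" using u(2) assms by (simp add: u0_def field_simps)
    finally have pb: "4 * lam * (1 - p) \<le> b / 2" .
    show ?thesis
    \<comment> \<open>From \<open>s \<ge> 3 * n0 + 1\<close> and \<open>s < 3 * n\<close> follows
      \<open>n \<ge> n0\<close>; the added 1 keeps the threshold positive for
      \<open>n0 = 0\<close>.\<close>
    proof (intro exI[of _ "3 * real n0 + 1"] conjI allI impI, goal_cases)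
      case (2 s M \<eta> X \<phi>)
      then interpret prob_space M by simp
      \<comment> \<open>The number of points \<open>3 i\<close> in \<open>{0..s}\<close> and also
        the least \<open>n\<close> with \<open>s < 3 * n\<close>, so that both bounds carry the same
        exponent.\<close>
      define n where "n = nat \<lfloor>s / 3\<rfloor> + 1"
      have s: "s > 0" using 2 by linarith
      then have n: "3 * (real n - 1) \<le> s" "s < 3 * real n"
        using floor_correct[of "s / 3"] s by (simp_all add: n_def field_simps)
      have "n \<ge> n0" using n 2 by linarith
      have "prob {\<omega> \<in> space M. closed_segment (0, 0) (s, 0) \<subseteq> iid_boolean (\<eta> \<omega>) (marginal_cdf M \<phi>)}
          \<le> (4 * lam * (1 - p)) ^ n"
        using 2 n s p u(1) assms
        by (intro prob_iid_boolean_le) (auto simp: p_def marginal_cdf_cylinder_field)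
      also have "\<dots> \<le> (b / 2) ^ n" using pb p assms by (intro power_mono) auto
      also have "\<dots> = (1/2) ^ n * b ^ n" by (simp add: power_divide)
      also have "\<dots> < (1 - exp (- (u / (3 * real n)))) * b ^ n"
        using n0[OF \<open>n \<ge> n0\<close>] b by (intro mult_strict_right_mono) auto
      also have "\<dots> \<le> prob {\<omega> \<in> space M. closed_segment (0, 0) (s, 0) \<subseteq> field_boolean (\<eta> \<omega>) (\<phi> \<omega>)}"
      proof -
        have \<phi>: "\<phi> = (\<lambda>\<omega>. cylinder_field 2 (X \<omega>))"
          and ind: "field_independent M \<eta> (\<lambda>\<omega>. cylinder_field 2 (X \<omega>))"
          using 2 by auto
        show ?thesis
          unfolding b_def \<phi> using 2 n s u(1) assms
          by (intro prob_field_boolean_ge ind) auto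
      qed
      finally show ?case .
    qed simp
  qed
  ultimately show ?thesis by blast
qed

end
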